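(* Let $\omega\in S_n$, let $\mathcal T_\omega$ be its tower diagram and $D_\omega$ its Rothe diagram. Then for every positive integer $j$, the number of cells of $\mathcal T_\omega$ in its $j$-th tower equals the number of elements of $D_\omega$ in column $j$, i.e. $|\{k:(j,k)\in\mathcal T_\omega\}|=|\{i:(i,j)\in D_\omega\}|$.
   Context: $s_i=(i,i+1)$; permutations compose as functions. A reduced word of $\omega$ is a word $\alpha_1\cdots\alpha_\ell$ with $\omega=s_{\alpha_1}\cdots s_{\alpha_\ell}$ and $\ell$ minimal. The Rothe diagram of $\omega\in S_n$ is $D_\omega=\{(i,j):1\le i,j\le n,\ j<\omega(i),\ i<\omega^{-1}(j)\}$ ($i$ = row, $j$ = column). A cell is a pair $(i,j)$ of integers with $i\ge 1$, $j\ge 0$. A tower diagram is a finite set $\mathcal T$ of cells such that $(i,j)\in\mathcal T$ and $0\le k\le j$ imply $(i,k)\in\mathcal T$; its $i$-th tower consists of the cells with first coordinate $i$. The cell $(i,j)$ lies on the diagonal $x+y=i+j$. Sliding: for a positive integer $\alpha$, $\alpha^{\searrow}\mathcal T$ is computed by the procedure $P(\gamma,m)$ started at $\gamma=\alpha$, $m=1$: (S1) if no cell $(i,j)\in\mathcal T$ with $i\ge m$ lies on $x+y=\gamma-1$: (a) if $(\gamma,0)\notin\mathcal T$ the result is $\mathcal T\cup\{(\gamma,0)\}$; (b) if $(\gamma,0)\in\mathcal T$, $(\gamma,1)\notin\mathcal T$ the slide terminates (without result); (c) if $(\gamma,0),(\gamma,1)\in\mathcal T$, continue with $P(\gamma+1,\gamma+1)$.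 (S2) Otherwise let $i\ge m$ be smallest with $(i,\gamma-1-i)\in\mathcal T$: (a) if $(i,\gamma-i)\notin\mathcal T$ the result is $\mathcal T\cup\{(i,\gamma-i)\}$; (b) if $(i,\gamma-i)\in\mathcal T$, $(i,\gamma-i+1)\notin\mathcal T$ the slide terminates; (c) if both are in $\mathcal T$, continue with $P(\gamma+1,i+1)$. The tower diagram $\mathcal T_\omega$ is obtained from $\varnothing$ by successively sliding $\alpha_1,\dots,\alpha_\ell$ for a reduced word $\alpha_1\cdots\alpha_\ell$ of $\omega$ (no slide terminates, and the result is independent of the chosen reduced word). *)

theory Defs
  imports "HOL-Combinatorics.Combinatorics"
begin

text \<open>An element of \<open>S\<^sub>n\<close> is a function \<open>w :: nat \<Rightarrow> nat\<close> with \<open>w permutes {1..n}\<close>, extended by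
  the identity outside \<open>{1..n}\<close>. In particular reduced words and tower diagrams do not
  mention \<open>n\<close>.\<close>

definition simple_transposition :: "nat \<Rightarrow> nat \<Rightarrow> nat" where
  "simple_transposition i = Transposition.transpose i (i + 1)"

definition word_perm :: "nat list \<Rightarrow> nat \<Rightarrow> nat" where
  "word_perm a = foldr (\<lambda>i f. simple_transposition i \<circ> f) a id"

definition word_for :: "(nat \<Rightarrow> nat) \<Rightarrow> nat list \<Rightarrow> bool" where
  "word_for w a \<longleftrightarrow> (\<forall>i\<in>set a. 1 \<le> i) \<and> w = word_perm a"

definition reduced_word :: "(nat \<Rightarrow> nat) \<Rightarrow> nat list \<Rightarrow> bool" where
  "reduced_word w a \<longleftrightarrow> word_for w a \<and> (\<forall>b. word_for w b \<longrightarrow> length a \<le> length b)"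

definition rothe_diagram :: "nat \<Rightarrow> (nat \<Rightarrow> nat) \<Rightarrow> (nat \<times> nat) set" where
  "rothe_diagram n w =
     {(i, j). 1 \<le> i \<and> i \<le> n \<and> 1 \<le> j \<and> j \<le> n \<and> j < w i \<and> i < inv w j}"

definition is_tower_diagram :: "(nat \<times> nat) set \<Rightarrow> bool" where
  "is_tower_diagram T \<longleftrightarrow> finite T \<and> (\<forall>(i, j)\<in>T. 1 \<le> i) \<and>
     (\<forall>i j k. (i, j) \<in> T \<longrightarrow> k \<le> j \<longrightarrow> (i, k) \<in> T)"

text \<open>\<open>first_hit T g m i j\<close>: among the cells of \<open>T\<close> in towers \<open>\<ge> m\<close> on the diagonal
  \<open>x + y = g - 1\<close>, the cell \<open>(i, j)\<close> is the one with the smallest first coordinate. The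
  diagonal is written as \<open>x + y + 1 = g\<close> because subtraction on \<open>nat\<close> truncates.\<close>

definition first_hit ::
    "(nat \<times> nat) set \<Rightarrow> nat \<Rightarrow> nat \<Rightarrow> nat \<Rightarrow> nat \<Rightarrow> bool" where
  "first_hit T g m i j \<longleftrightarrow> (i, j) \<in> T \<and> m \<le> i \<and> i + j + 1 = g \<and>
     (\<forall>i' j'. (i', j') \<in> T \<and> m \<le> i' \<and> i' + j' + 1 = g \<longrightarrow> i \<le> i')"

text \<open>\<open>slide_proc T g m T'\<close>: the procedure \<open>P(g, m)\<close> run on \<open>T\<close> yields the result \<open>T'\<close>.
  The situations in which the slide terminates without result
  (\<open>(g, 0) \<in> T\<close>, \<open>(g, 1) \<notin> T\<close>, respectively \<open>(i, j + 1) \<in> T\<close>, \<open>(i, j + 2) \<notin> T\<close>) have no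
  rule, so then no \<open>T'\<close> is related. In the last two rules \<open>g - i = j + 1\<close>.\<close>

inductive slide_proc ::
    "(nat \<times> nat) set \<Rightarrow> nat \<Rightarrow> nat \<Rightarrow> (nat \<times> nat) set \<Rightarrow> bool"
  for T :: "(nat \<times> nat) set" where
  S1a: "\<lbrakk>\<nexists>i j. (i, j) \<in> T \<and> m \<le> i \<and> i + j + 1 = g; (g, 0) \<notin> T\<rbrakk>
        \<Longrightarrow> slide_proc T g m (insert (g, 0) T)"
| S1c: "\<lbrakk>\<nexists>i j. (i, j) \<in> T \<and> m \<le> i \<and> i + j + 1 = g; (g, 0) \<in> T; (g, 1) \<in> T;
         slide_proc T (g + 1) (g + 1) T'\<rbrakk>
        \<Longrightarrow> slide_proc T g m T'"
| S2a: "\<lbrakk>first_hit T g m i j; (i, j + 1) \<notin> T\<rbrakk>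
        \<Longrightarrow> slide_proc T g m (insert (i, j + 1) T)"
| S2c: "\<lbrakk>first_hit T g m i j; (i, j + 1) \<in> T; (i, j + 2) \<in> T;
         slide_proc T (g + 1) (i + 1) T'\<rbrakk>
        \<Longrightarrow> slide_proc T g m T'"

definition slide :: "nat \<Rightarrow> (nat \<times> nat) set \<Rightarrow> (nat \<times> nat) set \<Rightarrow> bool" where
  "slide a T T' \<longleftrightarrow> slide_proc T a 1 T'"

primrec slide_word :: "nat list \<Rightarrow> (nat \<times> nat) set \<Rightarrow> (nat \<times> nat) set \<Rightarrow> bool" where
  "slide_word [] T T' \<longleftrightarrow> T' = T"
| "slide_word (a # as) T T' \<longleftrightarrow> (\<exists>U. slide a T U \<and> slide_word as U T')"

text \<open>The common result of sliding any reduced word of \<open>w\<close> into the empty diagram.\<close>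

definition tower_diagram :: "(nat \<Rightarrow> nat) \<Rightarrow> (nat \<times> nat) set" where
  "tower_diagram w =
     (THE T. is_tower_diagram T \<and> (\<forall>a. reduced_word w a \<longrightarrow> slide_word a {} T))"

end

theory Submission
  imports Defs
begin

text \<open>The column counts of the Rothe diagram form a Lehmer code of \<open>w\<close>. If \<open>w a < w (a + 1)\<close>, passing
  from \<open>w\<close> to \<open>w \<circ> s\<^sub>a\<close> adds one to the entry at \<open>w a\<close> and changes no other. The slide of \<open>a\<close>
  into the diagram with these tower heights also ends on top of tower \<open>w a\<close>: apart from the
  offset \<open>m\<close>, the parameter \<open>g\<close> of \<open>P(g, m)\<close> counts the \<open>x < a\<close> whose value \<open>w x\<close> is at least
  \<open>m\<close>, so that the slide looks for \<open>w a\<close> among \<open>m, m + 1, \<dots>\<close>. Reducedness means that every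
  letter of the word is such an ascent.\<close>

text \<open>Indexed by the value \<open>j\<close> rather than by its position, and free of
  \<open>n\<close>, as tower diagrams are. The bound \<open>x < inv w j\<close> makes the counted
  set finite for every \<open>w\<close>.\<close>

definition code :: "(nat \<Rightarrow> nat) \<Rightarrow> nat \<Rightarrow> nat" where
  "code w j = card {x. x < inv w j \<and> j < w x}"

definition code_diagram :: "(nat \<Rightarrow> nat) \<Rightarrow> (nat \<times> nat) set" where
  "code_diagram w = {(j, k). k < code w j}"

lemma mem_code_diagram [simp]: "(j, k) \<in> code_diagram w \<longleftrightarrow> k < code w j"
  by (simp add: code_diagram_def)

section \<open>Determinism of slides\<close>

lemma first_hit_unique:
  assumes "first_hit T g m i j" "first_hit T g m i' j'"
  shows "i' = i \<and> j' = j"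
  using assms unfolding first_hit_def by (metis add_left_cancel add_right_cancel le_antisym)

lemma first_hit_on_diagonal:
  "first_hit T g m i j \<Longrightarrow> \<exists>i j. (i, j) \<in> T \<and> m \<le> i \<and> i + j + 1 = g"
  unfolding first_hit_def by blast

text \<open>The four rules exclude one another: a hit on the diagonal separates S1 from S2, and the
  cell above separates (a) from (c). This yields the uniqueness behind \<open>THE\<close> in
  \<open>tower_diagram\<close>.\<close>

lemma slide_proc_deterministic:
  assumes "slide_proc T g m U" "slide_proc T g m V"
  shows "U = V"
  using assms
proof (induction arbitrary: V rule: slide_proc.induct)
  case (S1a m g)
  from S1a(3) show ?case
    by cases (use S1a(1,2) first_hit_on_diagonal in blast)+
next
  case (S1c m g T')
  from S1c(6) show ?case
    by cases (use S1c(1,2,5) first_hit_on_diagonal in blast)+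
next
  case (S2a g m i j)
  from S2a(3) show ?case
    by cases (use S2a(1,2) first_hit_on_diagonal first_hit_unique in blast)+
next
  case (S2c g m i j T')
  from S2c(6) show ?case
    by cases (use S2c(1,2,5) first_hit_on_diagonal first_hit_unique in blast)+
qed

lemma slide_word_deterministic:
  "slide_word a T U \<Longrightarrow> slide_word a T V \<Longrightarrow> U = V"
  by (induction a arbitrary: T) (auto simp: slide_def dest: slide_proc_deterministic)

lemma slide_word_append:
  "slide_word (a @ b) T V \<longleftrightarrow> (\<exists>U. slide_word a T U \<and> slide_word b U V)"
  by (induction a arbitrary: T) auto

section \<open>Sliding the position of an ascent\<close>

lemma slide_proc_skip_tower:
  assumes "slide_proc T g (Suc m) T'" and skip: "\<And>j. m + j + 1 = g \<Longrightarrow> (m, j) \<notin> T"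
  shows "slide_proc T g m T'"
proof -
  \<comment> \<open>The rules use \<open>m\<close> only to search the diagonal, and the search meets
    the same cells from \<open>m\<close> and from \<open>Suc m\<close>.\<close>
  have le: "(i, j) \<in> T \<and> m \<le> i \<and> i + j + 1 = g \<longleftrightarrow> (i, j) \<in> T \<and> Suc m \<le> i \<and> i + j + 1 = g"
    for i j
    using skip by (metis Suc_leD le_antisym not_less_eq_eq)
  have "first_hit T g k i j \<longleftrightarrow> ((i, j) \<in> T \<and> k \<le> i \<and> i + j + 1 = g) \<and>
      (\<forall>i' j'. (i', j') \<in> T \<and> k \<le> i' \<and> i' + j' + 1 = g \<longrightarrow> i \<le> i')" for k i j
    by (simp add: first_hit_def)
  then have hit: "first_hit T g m i j \<longleftrightarrow> first_hit T g (Suc m) i j" for i j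
    by (simp only: le)
  have no_hit: "(\<nexists>i j. (i, j) \<in> T \<and> m \<le> i \<and> i + j + 1 = g) \<longleftrightarrow>
      (\<nexists>i j. (i, j) \<in> T \<and> Suc m \<le> i \<and> i + j + 1 = g)"
    by (simp only: le)
  from assms(1) show ?thesis
  proof cases
    case S1a
    then show ?thesis
      using no_hit slide_proc.S1a by blast
  next
    case S1c
    then show ?thesis
      using no_hit slide_proc.S1c by blast
  next
    case (S2a i j)
    then show ?thesis
      using hit slide_proc.S2a by blast
  next
    case (S2c i j)
    then show ?thesis
      using hit slide_proc.S2c by blast
  qed
qed

text \<open>Downward induction on \<open>m\<close> from \<open>w a\<close>: each value
  \<open>m\<close> below \<open>w a\<close> is either passed over or crossed by the zigzag of the
  slide, according to whether its position lies before or after \<open>a\<close>.\<close>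

lemma slide_proc_code_diagram:
  assumes w: "bij w" and asc: "w a < w (Suc a)" and m: "m \<le> w a"
  shows "slide_proc (code_diagram w) (m + card {x. x < a \<and> m \<le> w x}) m
           (insert (w a, code w (w a)) (code_diagram w))"
  using m
proof (induction rule: inc_induct)
  case base
  have inv: "inv w (w a) = a"
    using w by (simp add: bij_is_inj)
  \<comment> \<open>Injectivity rules out equality, so \<open>g\<close> exceeds \<open>w a\<close>
    by exactly the height of tower \<open>w a\<close>: the diagonal meets its top cell, or the tower
    is empty.\<close>
  have "{x. x < a \<and> w a \<le> w x} = {x. x < a \<and> w a < w x}"
    using inj_eq[OF bij_is_inj[OF w]] by (auto simp: order_le_less)
  then have c: "card {x. x < a \<and> w a \<le> w x} = code w (w a)"
    by (simp add: code_def inv)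
  show ?case
  proof (cases "code w (w a)")
    case 0
    then show ?thesis
      unfolding c using slide_proc.S1a[of "code_diagram w" "w a" "w a"] by simp
  next
    case (Suc k)
    then have "first_hit (code_diagram w) (w a + code w (w a)) (w a) (w a) k"
      by (auto simp: first_hit_def)
    from slide_proc.S2a[OF this] show ?thesis
      unfolding c by (simp add: Suc)
  qed
next
  case (step m)
  define y where "y = inv w m"
  have wy: "w y = m"
    using w by (simp add: y_def bij_is_surj surj_f_inv_f)
  have w_eq: "w x = m \<longleftrightarrow> x = y" for x
    using inj_eq[OF bij_is_inj[OF w]] unfolding wy[symmetric] .
  have le_m: "m \<le> w x \<longleftrightarrow> x = y \<or> Suc m \<le> w x" for x
    using w_eq[of x] by linarith
  have ya: "y \<noteq> a" "y \<noteq> Suc a"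
    using wy step asc by auto
  define B where "B = {x. x < a \<and> Suc m \<le> w x}"
  have IH: "slide_proc (code_diagram w) (Suc m + card B) (Suc m)
      (insert (w a, code w (w a)) (code_diagram w))"
    using step.IH by (simp add: B_def)
  have [simp]: "finite B"
    by (simp add: B_def)
  have code: "code w m = card {x. x < y \<and> m < w x}"
    by (simp add: code_def y_def)
  show ?case
  proof (cases "y < a")
    case True
    \<comment> \<open>The count drops by one as \<open>m\<close> grows by one, so \<open>g\<close>
      is unchanged. Tower \<open>m\<close> has at most \<open>card B\<close> cells and stays below
      the diagonal.\<close>
    have "{x. x < a \<and> m \<le> w x} = insert y B"
      unfolding B_def le_m using True by blast
    then have "card {x. x < a \<and> m \<le> w x} = Suc (card B)"
      using wy by (simp add: B_def)
    moreover have "code w m \<le> card B"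
      unfolding code using True by (intro card_mono) (auto simp: B_def)
    ultimately show ?thesis
      using slide_proc_skip_tower[OF IH] by simp
  next
    case False
    have "{x. x < a \<and> m \<le> w x} = B"
      unfolding B_def le_m using False ya by blast
    \<comment> \<open>Now \<open>a\<close>, \<open>Suc a\<close> and all of \<open>B\<close> precede
      \<open>y\<close> and carry values above \<open>m\<close>. The two extra cells are those that
      case (c) requires; then \<open>g\<close> and \<open>m\<close> both grow by one.\<close>
    moreover have "card (insert a (insert (Suc a) B)) \<le> code w m"
      unfolding code using False ya step asc by (intro card_mono) (auto simp: B_def)
    then have gt: "card B + 2 \<le> code w m"
      by (simp add: B_def)
    moreover have "slide_proc (code_diagram w) (m + card B) m
        (insert (w a, code w (w a)) (code_diagram w))"
    proof (cases "card B")
      case 0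
      show ?thesis
        by (rule slide_proc.S1c) (use 0 gt IH in auto)
    next
      case (Suc k)
      with gt have "first_hit (code_diagram w) (m + card B) m m k"
        by (auto simp: first_hit_def)
      then show ?thesis
        by (rule slide_proc.S2c) (use gt Suc IH in auto)
    qed
    ultimately show ?thesis by simp
  qed
qed

text \<open>Since only 0 has value 0, the count for \<open>m = 1\<close> is \<open>a - 1\<close>,
  which gives the starting point P(a, 1).\<close>

lemma slide_code_diagram:
  assumes "bij w" "w 0 = 0" "1 \<le> a" "w a < w (Suc a)"
  shows "slide a (code_diagram w) (insert (w a, code w (w a)) (code_diagram w))"
proof -
  have pos: "1 \<le> w x \<longleftrightarrow> 1 \<le> x" for x
    using assms(1,2) by (metis bij_is_inj injD less_one not_le)
  have "{x. x < a \<and> 1 \<le> w x} = {1..<a}"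
    using pos by fastforce
  then have "1 + card {x. x < a \<and> 1 \<le> w x} = a"
    using assms(3) by simp
  with slide_proc_code_diagram[of w a 1] assms pos[of a] show ?thesis
    by (simp add: slide_def)
qed

section \<open>The code under an adjacent transposition\<close>

lemma inv_comp_simple_transposition:
  "bij w \<Longrightarrow> inv (w \<circ> simple_transposition a) j = simple_transposition a (inv w j)"
  by (subst o_inv_distrib) (simp_all add: simple_transposition_def)

lemma code_comp_simple_transposition:
  assumes w: "bij w" and asc: "w a < w (Suc a)"
  shows "code (w \<circ> simple_transposition a) j = code w j + of_bool (j = w a)"
proof -
  let ?s = "simple_transposition a"
  obtain y where j: "j = w y"
    using w by (metis bij_is_surj surjD)
  have inv: "inv w j = y"
    using w j by (simp add: bij_is_inj)
  have jeq: "j = w a \<longleftrightarrow> y = a"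
    using w j by (metis inv bij_is_inj inv_f_f)
  have code: "code (w \<circ> ?s) j = card {x. x < ?s y \<and> w y < w (?s x)}"
      "code w j = card {x. x < y \<and> w y < w x}"
    by (simp_all add: code_def inv_comp_simple_transposition w inv) (simp_all add: j)
  \<comment> \<open>The value at \<open>a\<close> moves behind the larger one and gains an
    inversion; the value at \<open>Suc a\<close> only passes a smaller one; for any other value the
    positions are merely relabelled.\<close>
  consider "y = a" | "y = Suc a" | "y \<noteq> a" "y \<noteq> Suc a" by blast
  then show ?thesis
  proof cases
    case 1
    have "{x. x < ?s y \<and> w y < w (?s x)} = insert a {x. x < y \<and> w y < w x}"
      using asc by (auto simp: 1 simple_transposition_def transpose_def)
    then show ?thesis
      unfolding code jeq by (simp add: 1)
  next
    case 2
    have "{x. x < ?s y \<and> w y < w (?s x)} = {x. x < y \<and> w y < w x}"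
      using asc by (auto simp: 2 simple_transposition_def transpose_def less_Suc_eq)
    then show ?thesis
      unfolding code jeq by (simp add: 2)
  next
    case 3
    have "bij_betw ?s {x. x < ?s y \<and> w y < w (?s x)} {x. x < y \<and> w y < w x}"
      using 3 by (intro bij_betw_byWitness[of _ ?s])
        (auto simp: simple_transposition_def transpose_def split: if_splits)
    from bij_betw_same_card[OF this] show ?thesis
      unfolding code jeq by (simp add: 3)
  qed
qed

lemma code_diagram_ascent:
  assumes "bij w" "w a < w (Suc a)"
  shows "code_diagram (w \<circ> simple_transposition a) =
    insert (w a, code w (w a)) (code_diagram w)"
  by (auto simp: code_comp_simple_transposition assms less_Suc_eq of_bool_def split: if_splits)

text \<open>The ascent case read backwards: \<open>v\<close> has an ascent at \<open>a\<close>, and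
  composing it with the same transposition gives back \<open>w\<close>.\<close>

lemma code_diagram_descent:
  assumes w: "bij w" and desc: "w (Suc a) < w a"
  defines "v \<equiv> w \<circ> simple_transposition a"
  shows "code_diagram w = insert (v a, code v (v a)) (code_diagram v)"
proof -
  have "w = v \<circ> simple_transposition a"
    by (simp add: v_def comp_assoc simple_transposition_def)
  moreover have "bij v"
    using w by (simp add: v_def simple_transposition_def bij_comp)
  moreover have "v a < v (Suc a)"
    using desc by (simp add: v_def simple_transposition_def)
  ultimately show ?thesis
    using code_diagram_ascent by metis
qed

section \<open>Words and the number of cells\<close>

lemma word_perm_Nil: "word_perm [] = id"
  unfolding word_perm_def foldr.simps by (rule id_apply)

lemma word_perm_snoc:
  "word_perm (a @ [i]) = word_perm a \<circ> simple_transposition i"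
  by (induction a) (auto simp: word_perm_def)

lemma bij_word_perm: "bij (word_perm a)"
proof (induction a rule: rev_induct)
  case Nil
  show ?case
    unfolding word_perm_Nil by (rule bij_id)
next
  case (snoc i a)
  then show ?case
    unfolding word_perm_snoc simple_transposition_def by (intro bij_comp) simp_all
qed

lemma word_perm_0: "\<forall>i\<in>set a. 1 \<le> i \<Longrightarrow> word_perm a 0 = 0"
  by (induction a rule: rev_induct)
    (simp_all add: word_perm_snoc simple_transposition_def transpose_def, simp add: word_perm_def)

lemma code_diagram_id: "code_diagram id = {}"
proof -
  have "code id j = 0" for j
    by (auto simp: code_def intro!: arg_cong[where f = card])
  then show ?thesis
    by auto
qed

text \<open>Each letter adds one cell at an ascent or removes one at a descent. Hence the number of
  cells is a lower bound for word length.\<close>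

lemma card_code_diagram_word_perm:
  "finite (code_diagram (word_perm a)) \<and> card (code_diagram (word_perm a)) \<le> length a"
proof (induction a rule: rev_induct)
  case Nil
  then show ?case
    unfolding word_perm_Nil code_diagram_id by simp
next
  case (snoc i a)
  let ?w = "word_perm a"
  have "?w i \<noteq> ?w (Suc i)"
    using bij_word_perm[of a] by (metis bij_is_inj injD n_not_Suc_n)
  then consider "?w i < ?w (Suc i)" | "?w (Suc i) < ?w i" by linarith
  then show ?case
  proof cases
    case 1
    then show ?thesis
      unfolding word_perm_snoc code_diagram_ascent[OF bij_word_perm 1]
      using snoc by (simp add: card_insert_if)
  next
    case 2
    have sub: "code_diagram (word_perm (a @ [i])) \<subseteq> code_diagram ?w"
      using code_diagram_descent[OF bij_word_perm 2] unfolding word_perm_snoc by blast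
    have "finite (code_diagram (word_perm (a @ [i])))"
      using sub snoc by (blast intro: finite_subset)
    moreover have "card (code_diagram (word_perm (a @ [i]))) \<le> card (code_diagram ?w)"
      using sub snoc by (blast intro: card_mono)
    ultimately show ?thesis
      using snoc by simp
  qed
qed

text \<open>The length hypothesis is the form in which reducedness is used: no letter may remove a
  cell, so every letter is an ascent and its slide is known.\<close>

lemma slide_word_code_diagram:
  assumes "\<forall>i\<in>set a. 1 \<le> i" "length a \<le> card (code_diagram (word_perm a))"
  shows "slide_word a {} (code_diagram (word_perm a))"
  using assms
proof (induction a rule: rev_induct)
  case Nil
  then show ?case
    unfolding word_perm_Nil code_diagram_id by simp
next
  case (snoc i a)
  let ?w = "word_perm a"
  define v where "v = word_perm (a @ [i])"
  have v_eq: "v = ?w \<circ> simple_transposition i"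
    unfolding v_def by (rule word_perm_snoc)
  have ne: "?w i \<noteq> ?w (Suc i)"
    using bij_word_perm[of a] by (metis bij_is_inj injD n_not_Suc_n)
  have asc: "?w i < ?w (Suc i)"
  \<comment> \<open>A descent would give the shorter word \<open>a\<close> a diagram with at least
    \<open>length a + 2\<close> cells.\<close>
  proof (rule ccontr)
    assume "\<not> ?w i < ?w (Suc i)"
    with ne have "code_diagram ?w = insert (v i, code v (v i)) (code_diagram v)"
      unfolding v_eq by (intro code_diagram_descent bij_word_perm) simp
    moreover have "finite (code_diagram v)"
      using card_code_diagram_word_perm[of "a @ [i]"] unfolding v_def ..
    ultimately have "card (code_diagram ?w) = Suc (card (code_diagram v))"
      by simp
    with snoc.prems(2)[folded v_def] card_code_diagram_word_perm[of a] show False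
      by simp
  qed
  have v: "code_diagram v = insert (?w i, code ?w (?w i)) (code_diagram ?w)"
    unfolding v_eq using asc by (intro code_diagram_ascent bij_word_perm)
  have "slide_word a {} (code_diagram ?w)"
    using snoc.IH snoc.prems[folded v_def] card_code_diagram_word_perm[of a] by (simp add: v)
  moreover have "slide i (code_diagram ?w) (code_diagram v)"
    unfolding v using snoc.prems asc
    by (intro slide_code_diagram bij_word_perm word_perm_0) auto
  ultimately show ?case
    unfolding v_def[symmetric] slide_word_append by auto
qed

section \<open>Attaining the length bound\<close>

lemma no_inversion_above:
  fixes n :: nat
  assumes w: "w permutes {1..n}" and "n < j"
  shows "{x. x < inv w j \<and> j < w x} = {}"
proof -
  have "w x \<le> n \<or> w x = x" for x
    using permutes_in_image[OF w, of x] permutes_not_in[OF w, of x] by (cases "x \<in> {1..n}") auto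
  moreover have "inv w j = j"
    using assms(2) by (intro permutes_not_in[OF permutes_inv[OF w]]) simp
  ultimately have "\<not> (x < inv w j \<and> j < w x)" for x
    using assms(2) by (metis less_asym less_le_trans)
  then show ?thesis by blast
qed

lemma finite_code_diagram:
  assumes "w permutes {1..n}"
  shows "finite (code_diagram w)"
proof (rule finite_subset)
  have "j \<le> n" if "k < code w j" for j k
    using that no_inversion_above[OF assms, of j] by (cases "n < j") (simp_all add: code_def)
  then show "code_diagram w \<subseteq> (SIGMA j:{..n}. {..<code w j})"
    by auto
qed simp

text \<open>Both \<open>w\<close> and its inverse are strictly increasing, so neither lies below the
  identity anywhere.\<close>

lemma bij_no_descent_eq_id:
  fixes w :: "nat \<Rightarrow> nat"
  assumes w: "bij w" and asc: "\<And>a. w a \<le> w (Suc a)"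
  shows "w = id"
proof
  fix x
  have "w a \<noteq> w (Suc a)" for a
    using w by (metis bij_is_inj injD n_not_Suc_n)
  with asc have mono: "strict_mono w"
    by (simp add: strict_mono_Suc_iff order_less_le)
  have w_inv: "w (inv w z) = z" for z
    using w by (simp add: bij_is_surj surj_f_inv_f)
  have "strict_mono (inv w)"
    by (rule strict_monoI) (metis mono w_inv strict_mono_less)
  then have "w x \<le> inv w (w x)"
    by (rule strict_mono_imp_increasing)
  moreover have "x \<le> w x"
    using mono by (rule strict_mono_imp_increasing)
  ultimately show "w x = id x"
    using w by (simp add: bij_is_inj)
qed

text \<open>Bubble sort: undoing a descent removes exactly one cell, and only the identity has no
  descent.\<close>

lemma exists_word_of_card_code_diagram:
  assumes "w permutes {1..n}"
  shows "\<exists>a. word_for w a \<and> length a = card (code_diagram w)"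
  using assms
proof (induction "card (code_diagram w)" arbitrary: w rule: less_induct)
  case less
  have w: "bij w"
    using less.prems by (rule permutes_bij)
  show ?case
  proof (cases "w = id")
    case True
    have "word_for w []"
      unfolding word_for_def True word_perm_Nil by simp
    then show ?thesis
      unfolding True code_diagram_id by auto
  next
    case False
    then obtain a where a: "w (Suc a) < w a"
      using bij_no_descent_eq_id[OF w] by (meson not_le)
    let ?v = "w \<circ> simple_transposition a"
    \<comment> \<open>The fixed points 0 and those beyond \<open>n\<close> confine the descent to 1,
      ..., n - 1, so the letter is legal and \<open>?v\<close> stays in the symmetric group.\<close>
    have a0: "1 \<le> a"
      using a permutes_not_in[OF less.prems, of 0] by (cases a) auto
    have an: "Suc a \<le> n"
    proof (rule ccontr)
      assume "\<not> Suc a \<le> n"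
      then have "w (Suc a) = Suc a" "w a \<le> a"
        using permutes_not_in[OF less.prems, of "Suc a"] permutes_not_in[OF less.prems, of a]
          permutes_in_image[OF less.prems, of a] by force+
      with a show False by simp
    qed
    have v: "?v permutes {1..n}"
      unfolding simple_transposition_def using a0 an
      by (intro permutes_compose[OF permutes_swap_id less.prems]) auto
    have card: "card (code_diagram w) = Suc (card (code_diagram ?v))"
      using code_diagram_descent[OF w a] finite_code_diagram[OF v] by simp
    with less.hyps v obtain b where b: "word_for ?v b" "length b = card (code_diagram ?v)"
      by auto
    have "w = word_perm (b @ [a])"
      using b(1) unfolding word_perm_snoc word_for_def
      by (metis comp_assoc comp_id simple_transposition_def transpose_comp_involutory)
    then have "word_for w (b @ [a])"
      using b(1) a0 by (auto simp: word_for_def)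
    then show ?thesis
      using b(2) card by (intro exI[of _ "b @ [a]"]) simp
  qed
qed

section \<open>Identification of the tower diagram\<close>

lemma tower_diagram_eq_code_diagram:
  assumes w: "w permutes {1..n}"
  shows "tower_diagram w = code_diagram w"
proof -
  obtain b where b: "word_for w b" "length b = card (code_diagram w)"
    using exists_word_of_card_code_diagram[OF w] by blast
  have bound: "card (code_diagram w) \<le> length a" if "word_for w a" for a
    using that card_code_diagram_word_perm[of a] by (simp add: word_for_def)
  \<comment> \<open>Existence of a reduced word is essential for uniqueness: otherwise the sliding
    condition under \<open>THE\<close> would be vacuous.\<close>
  have reduced: "reduced_word w b"
    using b bound by (simp add: reduced_word_def)
  have slides: "slide_word a {} (code_diagram w)" if "reduced_word w a" for a
  proof -
    have "\<forall>i\<in>set a. 1 \<le> i" "w = word_perm a" "length a \<le> card (code_diagram w)"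
      using that b by (auto simp: reduced_word_def word_for_def)
    then show ?thesis
      using slide_word_code_diagram by blast
  qed
  have "inv w 0 = 0"
    by (intro permutes_not_in[OF permutes_inv[OF w]]) simp
  then have "1 \<le> i" if "k < code w i" for i k
    using that by (cases i) (auto simp: code_def)
  then have "is_tower_diagram (code_diagram w)"
    using finite_code_diagram[OF w] by (fastforce simp: is_tower_diagram_def)
  with slides show ?thesis
    unfolding tower_diagram_def
    by (intro the_equality) (use reduced slide_word_deterministic in blast)+
qed

theorem theorem6p3:
  fixes n :: nat and w :: "nat \<Rightarrow> nat"
  assumes "w permutes {1..n}"
  shows "\<forall>j::nat. j \<ge> 1 \<longrightarrow>
    card {k. (j, k) \<in> tower_diagram w} = card {i. (i, j) \<in> rothe_diagram n w}"
proof (intro allI impI)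
  fix j :: nat
  assume j: "j \<ge> 1"
  \<comment> \<open>For \<open>j \<le> n\<close> the row bounds follow from
    \<open>x < inv w j \<le> n\<close> and \<open>w 0 = 0\<close>; for larger \<open>j\<close> both
    sets are empty.\<close>
  have "{i. (i, j) \<in> rothe_diagram n w} = {x. x < inv w j \<and> j < w x}"
  proof (cases "j \<le> n")
    case True
    have "inv w j \<le> n"
      using True j permutes_in_image[OF permutes_inv[OF assms], of j] by simp
    moreover have "1 \<le> x" if "j < w x" for x
      using that permutes_not_in[OF assms, of 0] by (cases x) auto
    ultimately show ?thesis
      using True j by (auto simp: rothe_diagram_def)
  next
    case False
    then show ?thesis
      using no_inversion_above[OF assms, of j] by (auto simp: rothe_diagram_def)
  qed
  moreover have "{k. (j, k) \<in> tower_diagram w} = {..<code w j}"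
    by (auto simp: tower_diagram_eq_code_diagram[OF assms])
  ultimately show "card {k. (j, k) \<in> tower_diagram w} = card {i. (i, j) \<in> rothe_diagram n w}"
    by (simp add: code_def)
qed

end
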